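(* Let $(P)$ be the constrained learning problem and $(D)$ its augmented dual problem, as defined in the context, with dual domain $T=\mathbb{R}^m\times(0,+\infty)$. Assume: (1) (Bounded objective) the function $\theta\mapsto \ell_0(f_\theta)$ is bounded below on $\Theta$. (2) (Closed domain) $\Theta\subseteq\mathbb{R}^p$ is closed. (3) (Continuity) the mapping $\theta\mapsto f_\theta$ is continuous (i.e. $\theta\mapsto f_\theta(x)$ is continuous on $\Theta$ for every $x\in\mathcal{X}$), and for each $i\in\{0,\dots,m\}$ the sample-wise loss $\bar\ell_i(\cdot,y)$ is continuous for every $y$ and uniformly bounded (there is $M_i<\infty$ with $|\bar\ell_i(v,y)|\le M_i$ for all $v$ and all $y$). (4) (Compact feasible level set) there exist real numbers $u>0$ and $\bar p>\inf(P)$ such that the set $$\{\theta\in\Theta:\ \ell_0(f_\theta)\le\bar p,\ \ \ell_i(f_\theta)\le u\ \text{ for all } i=1,\dots,m\}$$ is compact. Then strong duality holds: $$\inf(P)=\sup(D).$$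
   Context: Setting. $\Theta\subseteq\mathbb{R}^p$ is a parameter set, and for each $\theta\in\Theta$, $f_\theta:\mathcal{X}\to\mathcal{Y}$ is a parametrized (measurable) function. For $i=0,1,\dots,m$, $\mathcal{D}_i$ is a probability distribution of pairs $(x,y)$, $\bar\ell_i(\cdot,\cdot)$ is a real-valued (measurable) sample-wise loss, and the risk functional is $$\ell_i(f_\theta):=\mathbb{E}_{(x,y)\sim\mathcal{D}_i}\big[\bar\ell_i(f_\theta(x),y)\big]\in\mathbb{R}.$$ Primal problem $(P)$: minimize $\ell_0(f_\theta)$ over all $\theta\in\Theta$ subject to $\ell_i(f_\theta)\le 0$ for $i=1,\dots,m$. Its optimal value is denoted $\inf(P)$ (equal to $+\infty$ if there is no feasible point). Augmented Lagrangian: for $(\lambda,\alpha)\in T=\mathbb{R}^m\times(0,+\infty)$, $$L(\theta,\lambda,\alpha)=\ell_0(f_\theta)+\alpha\sum_{i=1}^m\Psi\Big(\ell_i(f_\theta),\frac{\lambda_i}{\alpha}\Big),\qquad \Psi(x,y)=\frac{(\max\{0,2x+y\})^2-y^2}{4}.$$ Augmented dual problem $(D)$: maximize $g(\lambda,\alpha):=\inf_{\theta\in\Theta}L(\theta,\lambda,\alpha)$ over $(\lambda,\alpha)\in T$. Its optimal value is $\sup(D):=\sup_{(\lambda,\alpha)\in T}g(\lambda,\alpha)$. *)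

theory Defs
  imports "HOL-Probability.Probability"
begin

definition risk ::
  "('x \<times> 'y) measure \<Rightarrow> ('y \<Rightarrow> 'y \<Rightarrow> real) \<Rightarrow> ('x \<Rightarrow> 'y) \<Rightarrow> real"
  where "risk D l h = (\<integral>z. l (h (fst z)) (snd z) \<partial>D)"

text \<open>
  In the following, \<open>r 0\<close> is the objective and \<open>r 1, \<dots>, r m\<close> are the constraint functions, all
  as functions of the parameter. Optimal values are taken in \<^typ>\<open>ereal\<close>, so that the infimum over
  an empty set is \<open>\<infinity>\<close> and an objective that is unbounded below has infimum \<open>-\<infinity>\<close>.
\<close>

definition primal_value :: "nat \<Rightarrow> 'a set \<Rightarrow> (nat \<Rightarrow> 'a \<Rightarrow> real) \<Rightarrow> ereal"
  where "primal_value m \<Theta> r = (INF \<theta>\<in>{\<theta>\<in>\<Theta>. \<forall>i\<in>{1..m}. r i \<theta> \<le> 0}. ereal (r 0 \<theta>))"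

definition Psi :: "real \<Rightarrow> real \<Rightarrow> real"
  where "Psi x y = ((max 0 (2 * x + y))\<^sup>2 - y\<^sup>2) / 4"

definition aug_lagrangian ::
  "nat \<Rightarrow> (nat \<Rightarrow> 'a \<Rightarrow> real) \<Rightarrow> 'a \<Rightarrow> (nat \<Rightarrow> real) \<Rightarrow> real \<Rightarrow> real"
  where "aug_lagrangian m r \<theta> lam \<alpha> = r 0 \<theta> + \<alpha> * (\<Sum>i=1..m. Psi (r i \<theta>) (lam i / \<alpha>))"

definition dual_function ::
  "nat \<Rightarrow> 'a set \<Rightarrow> (nat \<Rightarrow> 'a \<Rightarrow> real) \<Rightarrow> (nat \<Rightarrow> real) \<Rightarrow> real \<Rightarrow> ereal"
  where "dual_function m \<Theta> r lam \<alpha> = (INF \<theta>\<in>\<Theta>. ereal (aug_lagrangian m r \<theta> lam \<alpha>))"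

text \<open>A vector in \<open>\<real>\<^sup>m\<close> is an extensional function on \<open>{1..m}\<close>; \<open>m = 0\<close> is allowed.\<close>

definition dual_domain :: "nat \<Rightarrow> ((nat \<Rightarrow> real) \<times> real) set"
  where "dual_domain m = ({1..m} \<rightarrow>\<^sub>E UNIV) \<times> {0<..}"

definition dual_value :: "nat \<Rightarrow> 'a set \<Rightarrow> (nat \<Rightarrow> 'a \<Rightarrow> real) \<Rightarrow> ereal"
  where "dual_value m \<Theta> r = (SUP (lam, \<alpha>)\<in>dual_domain m. dual_function m \<Theta> r lam \<alpha>)"

end

(*
  Weak duality holds because Psi is nonpositive whenever its first argument is. For the converse it
  suffices to take zero multipliers, where the augmented Lagrangian is the quadratic penalty
  r_0 + alpha * (sum of (r_i)_+^2): if all penalty infima stayed below some c < inf (P), then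
  near-minimizers for alpha -> infinity would have vanishing infeasibility (r_0 is bounded below),
  hence lie in the compact level set and accumulate, by continuity of the risks, at a feasible
  point with objective at most c.
*)
theory Submission
  imports Defs
begin

text \<open>For \<open>x \<le> 0\<close> one has \<open>2 * x + y \<le> y\<close>, so
  \<open>max 0 (2 * x + y)\<close> lies between 0 and the absolute value of \<open>y\<close>. The
  sign of \<open>y\<close> is left free because the multipliers range over all of R^m.\<close>

lemma Psi_nonpos:
  assumes "x \<le> 0"
  shows "Psi x y \<le> 0"
proof -
  have "(max 0 (2 * x + y))\<^sup>2 \<le> y\<^sup>2"
    using assms by (subst abs_le_square_iff[symmetric]) auto
  then show ?thesis by (simp add: Psi_def)
qed

lemma Psi_zero_right: "Psi x 0 = (max 0 x)\<^sup>2"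
  by (auto simp: Psi_def max_def power2_eq_square)

lemma dual_value_le_primal_value: "dual_value m \<Theta> r \<le> primal_value m \<Theta> r"
  unfolding dual_value_def primal_value_def
proof (safe intro!: SUP_least INF_greatest)
  fix lam \<alpha> \<theta>
  assume dom: "(lam, \<alpha>) \<in> dual_domain m" and "\<theta> \<in> \<Theta>" and feas: "\<forall>i\<in>{1..m}. r i \<theta> \<le> 0"
  have "\<alpha> * (\<Sum>i=1..m. Psi (r i \<theta>) (lam i / \<alpha>)) \<le> 0"
    using dom feas by (intro mult_nonneg_nonpos sum_nonpos Psi_nonpos) (auto simp: dual_domain_def)
  then have "aug_lagrangian m r \<theta> lam \<alpha> \<le> r 0 \<theta>"
    by (simp add: aug_lagrangian_def)
  then show "dual_function m \<Theta> r lam \<alpha> \<le> ereal (r 0 \<theta>)"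
    unfolding dual_function_def using \<open>\<theta> \<in> \<Theta>\<close> by (intro INF_lower2[of \<theta>]) auto
qed

lemma dual_value_ge_penalty:
  assumes "\<alpha> > 0"
  shows "(INF \<theta>\<in>\<Theta>. ereal (r 0 \<theta> + \<alpha> * (\<Sum>i=1..m. (max 0 (r i \<theta>))\<^sup>2))) \<le> dual_value m \<Theta> r"
proof -
  \<comment> \<open>Members of \<open>dual_domain\<close> are extensional, so the zero multiplier
    has to be \<open>undefined\<close> outside \<open>{1..m}\<close>.\<close>
  define lam :: "nat \<Rightarrow> real" where "lam = restrict (\<lambda>_. 0) {1..m}"
  have "aug_lagrangian m r \<theta> lam \<alpha> = r 0 \<theta> + \<alpha> * (\<Sum>i=1..m. (max 0 (r i \<theta>))\<^sup>2)" for \<theta>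
    by (simp add: aug_lagrangian_def lam_def Psi_zero_right)
  moreover have "(lam, \<alpha>) \<in> dual_domain m"
    using assms by (simp add: dual_domain_def lam_def)
  ultimately show ?thesis
    unfolding dual_value_def by (intro SUP_upper2[of "(lam, \<alpha>)"]) (simp_all add: dual_function_def)
qed

lemma primal_value_le_dual_value:
  fixes \<Theta> :: "'a::metric_space set"
  assumes bdd: "bdd_below (r 0 ` \<Theta>)"
    and cont: "\<And>i. i \<le> m \<Longrightarrow> continuous_on \<Theta> (r i)"
    and "u > 0" and pbar: "ereal pbar > primal_value m \<Theta> r"
    and comp: "compact {\<theta>\<in>\<Theta>. r 0 \<theta> \<le> pbar \<and> (\<forall>i\<in>{1..m}. r i \<theta> \<le> u)}"
  shows "primal_value m \<Theta> r \<le> dual_value m \<Theta> r"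
proof (rule ccontr)
  define K where "K = {\<theta>\<in>\<Theta>. r 0 \<theta> \<le> pbar \<and> (\<forall>i\<in>{1..m}. r i \<theta> \<le> u)}"
  define pen where "pen \<theta> = (\<Sum>i=1..m. (max 0 (r i \<theta>))\<^sup>2)" for \<theta>
  have pen_ge: "(max 0 (r i \<theta>))\<^sup>2 \<le> pen \<theta>" if "i \<in> {1..m}" for i \<theta>
    unfolding pen_def using that by (intro member_le_sum) auto
  have pen_nonneg: "0 \<le> pen \<theta>" for \<theta>
    unfolding pen_def by (intro sum_nonneg) auto
  assume "\<not> primal_value m \<Theta> r \<le> dual_value m \<Theta> r"
  \<comment> \<open>Density provides a real number in the gap, so infinite optimal values need no
    separate treatment.\<close>
  then obtain c where c: "dual_value m \<Theta> r < ereal c" "ereal c < primal_value m \<Theta> r"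
    using ereal_dense2 not_le by metis
  then have "c < pbar"
    using pbar less_trans less_ereal.simps(1) by blast
  obtain B where B: "\<And>\<theta>. \<theta> \<in> \<Theta> \<Longrightarrow> B \<le> r 0 \<theta>"
    using bdd by (auto simp: bdd_below_def)
  have near_minimizer: "\<exists>\<theta>\<in>\<Theta>. r 0 \<theta> + \<alpha> * pen \<theta> < c" if "\<alpha> > 0" for \<alpha>
    using le_less_trans[OF dual_value_ge_penalty[OF that] c(1)] by (auto simp: INF_less_iff pen_def)
  \<comment> \<open>Starting value of the penalty parameter, chosen so that
    \<open>(c - B) / N \<le> u\<^sup>2\<close>. Every near-minimizer then violates each constraint
    by at most \<open>u\<close>, and the whole sequence lies in \<open>K\<close> without discarding
    initial terms. The absolute value and the added 1 make positivity immediate.\<close>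
  define N where "N = \<bar>c - B\<bar> / u\<^sup>2 + 1"
  have "N > 0"
    by (simp add: N_def add_nonneg_pos)
  then have "\<exists>\<theta>. \<forall>n. \<theta> n \<in> \<Theta> \<and> r 0 (\<theta> n) + (N + real n) * pen (\<theta> n) < c"
    by (intro choice) (metis near_minimizer add_pos_nonneg of_nat_0_le_iff)
  then obtain \<theta> where \<theta>: "\<And>n. \<theta> n \<in> \<Theta>" "\<And>n. r 0 (\<theta> n) + (N + real n) * pen (\<theta> n) < c"
    by blast
  \<comment> \<open>As the objective is at least \<open>B\<close>, the penalty term has at most
    \<open>c - B\<close> left of the budget \<open>c\<close>.\<close>
  have pen_le: "pen (\<theta> n) \<le> (c - B) / (N + real n)" for n
    using \<open>N > 0\<close> B[OF \<theta>(1)[of n]] \<theta>(2)[of n] by (simp add: field_simps)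
  have obj_le: "r 0 (\<theta> n) \<le> c" for n
  proof -
    have "0 \<le> (N + real n) * pen (\<theta> n)"
      using \<open>N > 0\<close> pen_nonneg by simp
    then show ?thesis using \<theta>(2)[of n] by linarith
  qed
  have "\<theta> n \<in> K" for n
  proof -
    have "\<bar>c - B\<bar> \<le> u\<^sup>2 * N"
      using \<open>u > 0\<close> by (simp add: N_def field_simps)
    also have "\<dots> \<le> u\<^sup>2 * (N + real n)"
      by (intro mult_left_mono) auto
    finally have "(c - B) / (N + real n) \<le> u\<^sup>2"
      using \<open>N > 0\<close> by (simp add: divide_le_eq)
    then have "(max 0 (r i (\<theta> n)))\<^sup>2 \<le> u\<^sup>2" if "i \<in> {1..m}" for i
      using pen_ge[OF that, of "\<theta> n"] pen_le[of n] by linarith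
    then have "max 0 (r i (\<theta> n)) \<le> u" if "i \<in> {1..m}" for i
      using that \<open>u > 0\<close> by (meson power2_le_imp_le less_imp_le)
    then show ?thesis
      using \<theta>(1) obj_le[of n] \<open>c < pbar\<close> by (auto simp: K_def)
  qed
  moreover have "seq_compact K"
    using comp by (simp add: K_def compact_imp_seq_compact)
  ultimately obtain \<theta>' s where "\<theta>' \<in> K" and s: "strict_mono s" and lim: "(\<theta> \<circ> s) \<longlonglongrightarrow> \<theta>'"
    by (meson seq_compactE)
  \<comment> \<open>Continuity of the risks is known only on \<Theta>; compactness of
    \<open>K\<close> is what keeps the limit there.\<close>
  then have "\<theta>' \<in> \<Theta>" by (simp add: K_def)
  have r_lim: "(\<lambda>n. r i (\<theta> (s n))) \<longlonglongrightarrow> r i \<theta>'" if "i \<le> m" for i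
    using continuous_on_tendsto_compose[OF cont[OF that] lim \<open>\<theta>' \<in> \<Theta>\<close>] \<theta>(1) by simp
  \<comment> \<open>The squared violation along the subsequence is bounded by
    \<open>(c - B) / (N + real (s n))\<close>, which tends to 0, so the violation at the limit
    vanishes.\<close>
  have "r i \<theta>' \<le> 0" if i: "i \<in> {1..m}" for i
  proof -
    have "(\<lambda>n. (max 0 (r i (\<theta> (s n))))\<^sup>2) \<longlonglongrightarrow> (max 0 (r i \<theta>'))\<^sup>2"
      using i by (intro tendsto_power tendsto_max tendsto_const r_lim) auto
    moreover have "filterlim (\<lambda>n. N + real (s n)) at_infinity sequentially"
      by (intro filterlim_at_top_imp_at_infinity filterlim_tendsto_add_at_top[OF tendsto_const]
          filterlim_compose[OF filterlim_real_sequentially] filterlim_subseq s)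
    then have "(\<lambda>n. (c - B) / (N + real (s n))) \<longlonglongrightarrow> 0"
      by (rule tendsto_divide_0[OF tendsto_const])
    moreover have "(max 0 (r i (\<theta> (s n))))\<^sup>2 \<le> (c - B) / (N + real (s n))" for n
      by (rule order_trans[OF pen_ge[OF i] pen_le])
    ultimately have "(max 0 (r i \<theta>'))\<^sup>2 \<le> 0"
      by (intro LIMSEQ_le) auto
    then show ?thesis by simp
  qed
  then have "primal_value m \<Theta> r \<le> ereal (r 0 \<theta>')"
    unfolding primal_value_def using \<open>\<theta>' \<in> \<Theta>\<close> by (intro INF_lower) auto
  moreover have "r 0 \<theta>' \<le> c"
    using r_lim[of 0] obj_le by (intro LIMSEQ_le_const2) auto
  ultimately show False
    using c(2) by (metis ereal_less_eq(3) leD order_trans)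
qed

text \<open>Dominated convergence along sequences, which suffice because the parameter space is
  first countable. The \<sigma>-algebra of \<open>Y\<close> is not tied to its topology, so
  measurability of the integrand comes from the joint measurability of \<open>l\<close>, not from
  its continuity.\<close>

lemma continuous_on_risk:
  fixes f :: "'a::{first_countable_topology, t2_space} \<Rightarrow> 'x \<Rightarrow> 'y::topological_space"
  assumes "prob_space D" and sets_D: "sets D = sets (X \<Otimes>\<^sub>M Y)"
    and f_meas: "\<And>\<theta>. \<theta> \<in> \<Theta> \<Longrightarrow> f \<theta> \<in> measurable X Y"
    and l_meas: "(\<lambda>(v, y). l v y) \<in> borel_measurable (Y \<Otimes>\<^sub>M Y)"
    and f_cont: "\<And>x. x \<in> space X \<Longrightarrow> continuous_on \<Theta> (\<lambda>\<theta>. f \<theta> x)"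
    and l_cont: "\<And>y. y \<in> space Y \<Longrightarrow> continuous_on (space Y) (\<lambda>v. l v y)"
    and l_bdd: "\<And>v y. v \<in> space Y \<Longrightarrow> y \<in> space Y \<Longrightarrow> \<bar>l v y\<bar> \<le> M"
  shows "continuous_on \<Theta> (\<lambda>\<theta>. risk D l (f \<theta>))"
proof (rule continuous_on_sequentiallyI)
  interpret prob_space D by fact
  have space_D: "space D = space X \<times> space Y"
    using sets_eq_imp_space_eq[OF sets_D] by (simp add: space_pair_measure)
  have meas: "(\<lambda>z. l (f \<theta> (fst z)) (snd z)) \<in> borel_measurable D" if "\<theta> \<in> \<Theta>" for \<theta>
  proof -
    have "(\<lambda>z. (f \<theta> (fst z), snd z)) \<in> measurable (X \<Otimes>\<^sub>M Y) (Y \<Otimes>\<^sub>M Y)"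
      using f_meas[OF that] by measurable
    from measurable_compose[OF this l_meas] show ?thesis
      using sets_D by (simp cong: measurable_cong_sets)
  qed
  fix \<theta> \<theta>' assume \<theta>: "\<forall>n. \<theta> n \<in> \<Theta>" and "\<theta>' \<in> \<Theta>" and lim: "\<theta> \<longlonglongrightarrow> \<theta>'"
  \<comment> \<open>Continuity and boundedness of the loss are assumed only on
    \<open>space Y\<close>, so the predictions must be known to stay in it.\<close>
  have f_space: "f t x \<in> space Y" if "t \<in> \<Theta>" "x \<in> space X" for t x
    using measurable_space[OF f_meas] that by blast
  show "(\<lambda>n. risk D l (f (\<theta> n))) \<longlonglongrightarrow> risk D l (f \<theta>')"
    unfolding risk_def
  proof (rule integral_dominated_convergence)
    show "AE z in D. (\<lambda>n. l (f (\<theta> n) (fst z)) (snd z)) \<longlonglongrightarrow> l (f \<theta>' (fst z)) (snd z)"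
    proof (rule AE_I2)
      fix z assume "z \<in> space D"
      then have z: "fst z \<in> space X" "snd z \<in> space Y" by (auto simp: space_D)
      have "(\<lambda>n. f (\<theta> n) (fst z)) \<longlonglongrightarrow> f \<theta>' (fst z)"
        using continuous_on_tendsto_compose[OF f_cont[OF z(1)] lim \<open>\<theta>' \<in> \<Theta>\<close>] \<theta> by simp
      then show "(\<lambda>n. l (f (\<theta> n) (fst z)) (snd z)) \<longlonglongrightarrow> l (f \<theta>' (fst z)) (snd z)"
        using \<theta> \<open>\<theta>' \<in> \<Theta>\<close> z f_space
        by (intro continuous_on_tendsto_compose[OF l_cont[OF z(2)]]) auto
    qed
    \<comment> \<open>The dominating function is the constant \<open>M\<close>, integrable because
      \<open>D\<close> is a probability measure.\<close>
    show "AE z in D. norm (l (f (\<theta> n) (fst z)) (snd z)) \<le> M" for n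
      using \<theta> f_space l_bdd by (intro AE_I2) (auto simp: space_D)
  qed (use meas \<theta> \<open>\<theta>' \<in> \<Theta>\<close> in auto)
qed

theorem theorem2p1:
  fixes m :: nat
    and \<Theta> :: "(real ^ 'p) set"
    and X :: "'x measure"
    and Y :: "'y::topological_space measure"
    and f :: "real ^ 'p \<Rightarrow> 'x \<Rightarrow> 'y"
    and D :: "nat \<Rightarrow> ('x \<times> 'y) measure"
    and l :: "nat \<Rightarrow> 'y \<Rightarrow> 'y \<Rightarrow> real"
    and r :: "nat \<Rightarrow> real ^ 'p \<Rightarrow> real"
  defines "r \<equiv> \<lambda>i \<theta>. risk (D i) (l i) (f \<theta>)"
  assumes f_measurable: "\<And>\<theta>. \<theta> \<in> \<Theta> \<Longrightarrow> f \<theta> \<in> measurable X Y"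
    and D_prob: "\<And>i. i \<le> m \<Longrightarrow> prob_space (D i)"
    and D_sets: "\<And>i. i \<le> m \<Longrightarrow> sets (D i) = sets (X \<Otimes>\<^sub>M Y)"
    and l_measurable: "\<And>i. i \<le> m \<Longrightarrow> (\<lambda>(v, y). l i v y) \<in> borel_measurable (Y \<Otimes>\<^sub>M Y)"
    and bounded_objective: "bdd_below (r 0 ` \<Theta>)"
    and closed_domain: "closed \<Theta>"
    and f_continuous: "\<And>x. x \<in> space X \<Longrightarrow> continuous_on \<Theta> (\<lambda>\<theta>. f \<theta> x)"
    and l_continuous: "\<And>i y. i \<le> m \<Longrightarrow> y \<in> space Y \<Longrightarrow> continuous_on (space Y) (\<lambda>v. l i v y)"
    and l_bounded: "\<And>i. i \<le> m \<Longrightarrow> \<exists>M. \<forall>v\<in>space Y. \<forall>y\<in>space Y. \<bar>l i v y\<bar> \<le> M"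
    and compact_level_set: "\<exists>u pbar. u > 0 \<and> ereal pbar > primal_value m \<Theta> r \<and>
      compact {\<theta>\<in>\<Theta>. r 0 \<theta> \<le> pbar \<and> (\<forall>i\<in>{1..m}. r i \<theta> \<le> u)}"
  shows "primal_value m \<Theta> r = dual_value m \<Theta> r"
proof (rule antisym)
  obtain u pbar where up: "u > 0" "ereal pbar > primal_value m \<Theta> r"
    "compact {\<theta>\<in>\<Theta>. r 0 \<theta> \<le> pbar \<and> (\<forall>i\<in>{1..m}. r i \<theta> \<le> u)}"
    using compact_level_set by blast
  have "continuous_on \<Theta> (r i)" if i: "i \<le> m" for i
  proof -
    \<comment> \<open>The bound may depend on \<open>i\<close>, since each risk is treated
      separately.\<close>
    obtain M where "\<And>v y. v \<in> space Y \<Longrightarrow> y \<in> space Y \<Longrightarrow> \<bar>l i v y\<bar> \<le> M"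
      using l_bounded[OF i] by blast
    then show ?thesis
      unfolding r_def
      by (intro continuous_on_risk[OF D_prob[OF i] D_sets[OF i] f_measurable l_measurable[OF i]
            f_continuous l_continuous[OF i]])
  qed
  then show "primal_value m \<Theta> r \<le> dual_value m \<Theta> r"
    using bounded_objective up by (intro primal_value_le_dual_value)
qed (rule dual_value_le_primal_value)

end
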